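(* Let $n\ge1$ and $p\in(0,1)$. Build a random set $X\subseteq[n]^2$ by including each ordered pair $(i,j)$ with $i\neq j$ independently with probability $1-p$ (equivalently, $G_n(X)$ is the random digraph $\vec{G}(n,p)$ on $[n]$ in which each directed edge $i\to j$, $i\ne j$, appears independently with probability $p$). Let $Y=d_X(\emptyset;n)$, equivalently the number of Hamiltonian paths in $\vec{G}(n,p)$. Then \[ \mathbb{P}\Bigl(Y\ge\tfrac12\,n!\,p^{n-1}\Bigr)\ge\tfrac14\exp(1-1/p). \]
   Context: $[n]=\{1,\dots,n\}$. For $\pi=\pi_1\cdots\pi_n\in\mathfrak{S}_n$, $\mathrm{XDes}(\pi)=\{i\in[n-1]:(\pi_i,\pi_{i+1})\in X\}$, and $d_X(\emptyset;n)$ is the number of $\pi\in\mathfrak{S}_n$ with $\mathrm{XDes}(\pi)=\emptyset$. $G_n(X)$ is the digraph on $[n]$ with an edge $i\to j$ iff $i\ne j$ and $(i,j)\notin X$. *)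

theory Defs
  imports "HOL-Probability.Probability" "Graph_Theory.Vertex_Walk" "Graph_Theory.Pair_Digraph"
begin

definition XDes :: "(nat \<times> nat) set \<Rightarrow> nat \<Rightarrow> (nat \<Rightarrow> nat) \<Rightarrow> nat set" where
  "XDes X n \<pi> = {i \<in> {1..n - 1}. (\<pi> i, \<pi> (i + 1)) \<in> X}"

definition d_X :: "(nat \<times> nat) set \<Rightarrow> nat set \<Rightarrow> nat \<Rightarrow> nat" where
  "d_X X I n = card {\<pi>. \<pi> permutes {1..n} \<and> XDes X n \<pi> = I}"

definition offdiag_pairs :: "nat \<Rightarrow> (nat \<times> nat) set" where
  "offdiag_pairs n = {(i, j). i \<in> {1..n} \<and> j \<in> {1..n} \<and> i \<noteq> j}"

text \<open>The law of a random subset of \<open>A\<close> in which each element is included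
  independently with probability \<open>q\<close> (for finite \<open>A\<close>).\<close>

definition random_subset_pmf :: "'a set \<Rightarrow> real \<Rightarrow> 'a set pmf" where
  "random_subset_pmf A q =
     map_pmf (\<lambda>f. {a \<in> A. f a}) (Pi_pmf A False (\<lambda>_. bernoulli_pmf q))"

definition random_X_pmf :: "nat \<Rightarrow> real \<Rightarrow> (nat \<times> nat) set pmf" where
  "random_X_pmf n p = random_subset_pmf (offdiag_pairs n) (1 - p)"

definition G_digraph :: "nat \<Rightarrow> (nat \<times> nat) set \<Rightarrow> nat pair_pre_digraph" where
  "G_digraph n X = \<lparr> pverts = {1..n}, parcs = offdiag_pairs n - X \<rparr>"

definition hamiltonian_paths :: "'a pair_pre_digraph \<Rightarrow> 'a list set" where
  "hamiltonian_paths G = {xs. vpath xs (with_proj G) \<and> set xs = pverts G}"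

text \<open>Counting permutations without X-descents is counting Hamiltonian paths, and
  the digraph of the random set is the binomial random digraph.\<close>

lemma set_vwalk_arcs: "set (vwalk_arcs xs) = {(xs ! i, xs ! (i + 1)) | i. i + 1 < length xs}"
proof (induction xs rule: vwalk_arcs.induct)
  case (3 x y xs)
  have "{((x # y # xs) ! i, (x # y # xs) ! (i + 1)) | i. i + 1 < length (x # y # xs)} =
        insert (x, y) {((y # xs) ! i, (y # xs) ! (i + 1)) | i. i + 1 < length (y # xs)}"
    (is "?L = ?R")
  proof (intro equalityI subsetI)
    fix e assume "e \<in> ?L"
    then obtain i where i: "e = ((x # y # xs) ! i, (x # y # xs) ! (i + 1))"
        "i + 1 < length (x # y # xs)" by blast
    show "e \<in> ?R"
      using i by (cases i) auto
  next
    fix e assume "e \<in> ?R"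
    then consider "e = (x, y)"
      | i where "e = ((y # xs) ! i, (y # xs) ! (i + 1))" "i + 1 < length (y # xs)" by blast
    then show "e \<in> ?L"
    proof cases
      case 1
      then show ?thesis by (intro CollectI exI[of _ 0]) auto
    next
      case (2 i)
      then show ?thesis by (intro CollectI exI[of _ "Suc i"]) auto
    qed
  qed
  then show ?case using "3.IH" by simp
qed auto

lemma d_X_empty_eq_card_hamiltonian_paths:
  assumes "n \<ge> 1"
  shows "d_X X {} n = card (hamiltonian_paths (G_digraph n X))"
proof -
  let ?S = "{\<pi>. \<pi> permutes {1..n} \<and> XDes X n \<pi> = {}}"
  let ?f = "\<lambda>\<pi>::nat \<Rightarrow> nat. map \<pi> [1..<Suc n]"
  have nth: "?f \<pi> ! i = \<pi> (Suc i)" if "i < n" for \<pi> :: "nat \<Rightarrow> nat" and i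
    using that by (simp del: upt_Suc)
  have ham: "?f \<pi> \<in> hamiltonian_paths (G_digraph n X) \<longleftrightarrow> XDes X n \<pi> = {}"
    if perm: "\<pi> permutes {1..n}" for \<pi>
  proof -
    have set: "set (?f \<pi>) = {1..n}"
      using permutes_image[OF perm] by (simp del: upt_Suc add: atLeastLessThanSuc_atLeastAtMost)
    have dist: "distinct (?f \<pi>)"
      using permutes_inj_on[OF perm] by (simp del: upt_Suc add: distinct_map)
    have arcs: "set (vwalk_arcs (?f \<pi>)) = {(\<pi> i, \<pi> (i + 1)) | i. i \<in> {1..n - 1}}"
    proof -
      have "set (vwalk_arcs (?f \<pi>)) = {(\<pi> (Suc i), \<pi> (Suc (Suc i))) | i. Suc i < n}"
      proof -
        have "(?f \<pi> ! i, ?f \<pi> ! (i + 1)) = (\<pi> (Suc i), \<pi> (Suc (Suc i)))" if "Suc i < n" for i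
          using that nth[of i] nth[of "Suc i"] by simp
        moreover have "i + 1 < length (?f \<pi>) \<longleftrightarrow> Suc i < n" for i
          by simp
        ultimately show ?thesis
          unfolding set_vwalk_arcs by (intro Collect_cong ex_cong1) metis
      qed
      also have "\<dots> = {(\<pi> i, \<pi> (i + 1)) | i. i \<in> {1..n - 1}}"
      proof (intro equalityI subsetI)
        fix e assume "e \<in> {(\<pi> i, \<pi> (i + 1)) | i. i \<in> {1..n - 1}}"
        then obtain i where "e = (\<pi> i, \<pi> (i + 1))" "i \<in> {1..n - 1}" by blast
        then show "e \<in> {(\<pi> (Suc i), \<pi> (Suc (Suc i))) | i. Suc i < n}"
          by (intro CollectI exI[of _ "i - 1"]) auto
      qed fastforce
      finally show ?thesis .
    qed
    have off: "(\<pi> i, \<pi> (i + 1)) \<in> offdiag_pairs n" if "i \<in> {1..n - 1}" for i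
    proof -
      have "\<pi> i \<in> {1..n}" "\<pi> (i + 1) \<in> {1..n}"
        using that permutes_in_image[OF perm, of i] permutes_in_image[OF perm, of "i + 1"]
        by auto
      moreover have "\<pi> i \<noteq> \<pi> (i + 1)"
        using permutes_inj[OF perm] by (simp add: inj_eq)
      ultimately show ?thesis
        by (simp add: offdiag_pairs_def)
    qed
    have "?f \<pi> \<in> hamiltonian_paths (G_digraph n X) \<longleftrightarrow>
          set (vwalk_arcs (?f \<pi>)) \<subseteq> offdiag_pairs n - X"
      unfolding hamiltonian_paths_def vpath_def vwalk_def G_digraph_def
      using set dist assms by (auto simp del: upt_Suc)
    also have "\<dots> \<longleftrightarrow> XDes X n \<pi> = {}"
      unfolding arcs XDes_def using off by blast
    finally show ?thesis .
  qed
  have "inj_on ?f ?S"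
  proof (rule inj_onI)
    fix \<pi> \<sigma> assume *: "\<pi> \<in> ?S" "\<sigma> \<in> ?S" "?f \<pi> = ?f \<sigma>"
    show "\<pi> = \<sigma>"
    proof
      fix i
      show "\<pi> i = \<sigma> i"
      proof (cases "i \<in> {1..n}")
        case True
        then show ?thesis using *(3) by (auto simp del: upt_Suc simp: map_eq_conv)
      next
        case False
        then show ?thesis using * by (auto simp: permutes_not_in simp del: upt_Suc)
      qed
    qed
  qed
  moreover have "?f ` ?S = hamiltonian_paths (G_digraph n X)"
  proof (intro equalityI subsetI)
    fix xs assume "xs \<in> ?f ` ?S"
    then obtain \<pi> where \<pi>: "\<pi> \<in> ?S" "xs = ?f \<pi>" by (rule imageE)
    then show "xs \<in> hamiltonian_paths (G_digraph n X)"
      using ham[of \<pi>] by blast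
  next
    fix xs assume xs: "xs \<in> hamiltonian_paths (G_digraph n X)"
    then have xs': "distinct xs" "set xs = {1..n}"
      by (auto simp: hamiltonian_paths_def vpath_def G_digraph_def)
    then have len: "length xs = n"
      using distinct_card by fastforce
    define \<pi> where "\<pi> i = (if i \<in> {1..n} then xs ! (i - 1) else i)" for i
    have f: "?f \<pi> = xs"
      using len nth[of _ \<pi>] by (intro nth_equalityI) (auto simp: \<pi>_def simp del: upt_Suc)
    have "\<pi> ` {1..n} = {1..n}"
      using arg_cong[OF f, of set] xs'(2)
      by (simp del: upt_Suc add: atLeastLessThanSuc_atLeastAtMost)
    then have "bij_betw \<pi> {1..n} {1..n}"
      by (simp add: bij_betw_def eq_card_imp_inj_on)
    then have "\<pi> permutes {1..n}"
      by (rule bij_imp_permutes) (auto simp: \<pi>_def)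
    then show "xs \<in> ?f ` ?S"
      using ham[of \<pi>] xs f by (intro image_eqI[of _ _ \<pi>]) auto
  qed
  ultimately show ?thesis
    unfolding d_X_def using card_image[of ?f ?S] by (simp del: upt_Suc)
qed

lemma parcs_random_G_digraph:
  assumes "0 \<le> p" "p \<le> 1"
  shows "map_pmf (\<lambda>X. parcs (G_digraph n X)) (random_X_pmf n p) =
         random_subset_pmf (offdiag_pairs n) p"
proof -
  let ?A = "offdiag_pairs n"
  have "finite ?A"
    by (rule finite_subset[of _ "{1..n} \<times> {1..n}"]) (auto simp: offdiag_pairs_def)
  note fin = this
  have bern: "bernoulli_pmf p = map_pmf Not (bernoulli_pmf (1 - p))"
  proof (rule pmf_eqI)
    fix b
    have "pmf (map_pmf Not (bernoulli_pmf (1 - p))) (\<not> (\<not> b)) = pmf (bernoulli_pmf (1 - p)) (\<not> b)"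
      by (rule pmf_map_inj') (auto simp: inj_def)
    then show "pmf (bernoulli_pmf p) b = pmf (map_pmf Not (bernoulli_pmf (1 - p))) b"
      using assms by (cases b) auto
  qed
  have "Pi_pmf ?A True (\<lambda>_. bernoulli_pmf p) =
        map_pmf (\<lambda>h. Not \<circ> h) (Pi_pmf ?A False (\<lambda>_. bernoulli_pmf (1 - p)))"
    unfolding bern by (rule Pi_pmf_map) (use fin in auto)
  moreover have "Pi_pmf ?A False (\<lambda>_. bernoulli_pmf p) =
        map_pmf (\<lambda>f x. if x \<in> ?A then f x else False) (Pi_pmf ?A True (\<lambda>_. bernoulli_pmf p))"
    by (rule Pi_pmf_default_swap[OF fin, symmetric])
  ultimately show ?thesis
    unfolding random_X_pmf_def random_subset_pmf_def G_digraph_def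
    by (auto simp: map_pmf_comp intro!: map_pmf_cong)
qed

end

theory Submission
  imports Defs
begin

text \<open>
  Second moment method. Two paths on \<open>n\<close> vertices that share \<open>k\<close> arcs are both present with
  probability \<open>p ^ (2 * (n - 1) - k)\<close>, so the ratio of the second moment of \<open>Y\<close> to its squared mean is
  the average of \<open>(1/p)\<^sup>k\<close> over one of the paths, the other one being fixed. Put \<open>x = 1/p - 1\<close> and expand
  \<open>(1 + x)\<^sup>k\<close> over the sets of shared arcs: a set of \<open>j\<close> arcs lies on at most \<open>(n - j)!\<close> paths,
  so the average is at most the sum of \<open>binomial (n-1) j * (n-j)!/n! * x\<^sup>j\<close>, which is termwise
  at most \<open>x\<^sup>j/j!\<close>. Hence the ratio is at most \<open>exp (1/p - 1)\<close>, and the Paley-Zygmund inequality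
  concludes.
\<close>

section \<open>Lists containing prescribed arcs\<close>

lemma successively_iff_vwalk_arcs:
  "successively P xs \<longleftrightarrow> (\<forall>(a, b) \<in> set (vwalk_arcs xs). P a b)"
  by (induction xs rule: vwalk_arcs.induct) auto

lemma vwalk_arcs_subset: "set (vwalk_arcs xs) \<subseteq> set xs \<times> set xs"
  by (induction xs rule: vwalk_arcs.induct) auto

lemma vwalk_arcs_offdiag:
  assumes "distinct xs"
  shows "set (vwalk_arcs xs) \<subseteq> {(i, j). i \<in> set xs \<and> j \<in> set xs \<and> i \<noteq> j}"
  using assms by (induction xs rule: vwalk_arcs.induct) auto

lemma card_vwalk_arcs:
  assumes "distinct xs"
  shows "card (set (vwalk_arcs xs)) = length xs - 1"
  using assms
proof (induction xs rule: vwalk_arcs.induct)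
  case (3 x y xs)
  moreover have "(x, y) \<notin> set (vwalk_arcs (y # xs))"
    using "3.prems" vwalk_arcs_subset[of "y # xs"] by auto
  ultimately show ?case by simp
qed auto

lemma vwalk_arcs_tail_unique:
  assumes "distinct xs" "(a, b) \<in> set (vwalk_arcs xs)" "(a, c) \<in> set (vwalk_arcs xs)"
  shows "b = c"
  using assms
proof (induction xs rule: vwalk_arcs.induct)
  case (3 x y xs)
  then show ?case using vwalk_arcs_subset[of "y # xs"] by auto
qed auto

lemma vwalk_arcs_head_unique:
  assumes "distinct xs" "(a, c) \<in> set (vwalk_arcs xs)" "(b, c) \<in> set (vwalk_arcs xs)"
  shows "a = b"
  using assms
proof (induction xs rule: vwalk_arcs.induct)
  case (3 x y xs)
  \<comment> \<open>\<open>y\<close> is the first vertex of the remaining list and does not recur,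
    so no later arc enters it.\<close>
  have "(d, y) \<notin> set (vwalk_arcs (y # xs))" for d
    using "3.prems"(1) vwalk_arcs_subset[of xs] by (cases xs) auto
  then show ?case using 3 by auto
qed auto

lemma hd_notin_Range_vwalk_arcs:
  assumes "distinct xs"
  shows "hd xs \<notin> Range (set (vwalk_arcs xs))"
  using assms vwalk_arcs_subset by (cases xs rule: vwalk_arcs.cases) fastforce+

lemma last_notin_Domain_vwalk_arcs:
  assumes "distinct xs"
  shows "last xs \<notin> Domain (set (vwalk_arcs xs))"
  using assms by (induction xs rule: vwalk_arcs.induct) auto

text \<open>Follow both lists from the common vertex \<open>a\<close>. If \<open>a\<close> is a tail
  in \<open>S\<close>, single-valuedness forces the same successor in both; if not, neither
  successor is a head in \<open>S\<close>, so both survive the filter and agree. The conditions on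
  \<open>last\<close> keep one list from stopping where the other goes on.\<close>

lemma filter_Range_eq_imp_eq:
  assumes "single_valued S"
    and "successively (\<lambda>a b. a \<in> Domain S \<or> b \<in> Range S \<longrightarrow> (a, b) \<in> S) (a # xs)"
    and "last (a # xs) \<notin> Domain S"
    and "successively (\<lambda>a b. a \<in> Domain S \<or> b \<in> Range S \<longrightarrow> (a, b) \<in> S) (a # ys)"
    and "last (a # ys) \<notin> Domain S"
    and "filter (\<lambda>v. v \<notin> Range S) xs = filter (\<lambda>v. v \<notin> Range S) ys"
  shows "xs = ys"
  using assms(2-)
proof (induction xs arbitrary: a ys)
  case Nil
  show ?case
  proof (cases ys)
    case (Cons c cs)
    then show ?thesis using Nil by (auto split: if_splits)
  qed simp
next
  case (Cons b bs)
  show ?case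
  proof (cases ys)
    case Nil
    then show ?thesis using Cons.prems by (auto split: if_splits)
  next
    case ys: (Cons c cs)
    have "b = c \<and> filter (\<lambda>v. v \<notin> Range S) bs = filter (\<lambda>v. v \<notin> Range S) cs"
    proof (cases "a \<in> Domain S")
      case True
      then have "(a, b) \<in> S" "(a, c) \<in> S" using Cons.prems ys by auto
      moreover from this have "b = c" using assms(1) by (auto dest: single_valuedD)
      ultimately show ?thesis using Cons.prems(5) ys by (auto split: if_splits)
    next
      case False
      then have "b \<notin> Range S" "c \<notin> Range S" using Cons.prems ys by auto
      then show ?thesis using Cons.prems(5) ys by simp
    qed
    then show ?thesis using Cons.IH[of b cs] Cons.prems ys by auto
  qed
qed

text \<open>A list containing the arcs in \<open>S\<close> is determined by the order of the vertices that are
  not heads of arcs in \<open>S\<close>: every other vertex is forced to follow its tail.\<close>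

lemma card_permutations_containing_arcs_le:
  assumes "finite V"
  shows "card {xs \<in> permutations_of_set V. S \<subseteq> set (vwalk_arcs xs)} \<le> fact (card V - card S)"
proof (cases "{xs \<in> permutations_of_set V. S \<subseteq> set (vwalk_arcs xs)} = {}")
  case False
  let ?L = "{xs \<in> permutations_of_set V. S \<subseteq> set (vwalk_arcs xs)}"
  let ?f = "filter (\<lambda>v. v \<notin> Range S)"
  \<comment> \<open>One witness shows that \<open>S\<close> is a partial injection inside
    \<open>V\<close>, so exactly \<open>card S\<close> vertices are heads.\<close>
  from False obtain zs where zs: "distinct zs" "set zs = V" "S \<subseteq> set (vwalk_arcs zs)"
    by (auto simp: permutations_of_set_def)
  have sv: "single_valued S"
    using vwalk_arcs_tail_unique[OF zs(1)] zs(3) by (meson single_valuedI subsetD)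
  have "inj_on snd S"
    using vwalk_arcs_head_unique[OF zs(1)] zs(3) by (fastforce simp: inj_on_def)
  then have card_Range: "card (Range S) = card S"
    by (simp add: Range_snd card_image)
  have Range: "Range S \<subseteq> V"
    using zs vwalk_arcs_subset[of zs] by auto
  \<comment> \<open>An arc of \<open>xs\<close> sharing its tail or its head with an arc of
    \<open>S\<close> must be that arc, since both lie on the distinct list
    \<open>xs\<close>.\<close>
  have succ: "successively (\<lambda>a b. a \<in> Domain S \<or> b \<in> Range S \<longrightarrow> (a, b) \<in> S) xs"
    if "xs \<in> ?L" for xs
  proof -
    have "distinct xs" "S \<subseteq> set (vwalk_arcs xs)"
      using that by (auto simp: permutations_of_set_def)
    then show ?thesis
      unfolding successively_iff_vwalk_arcs
      using vwalk_arcs_tail_unique[of xs] vwalk_arcs_head_unique[of xs] by blast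
  qed
  have last: "last xs \<notin> Domain S" and hd: "hd xs \<notin> Range S" if "xs \<in> ?L" for xs
    using that last_notin_Domain_vwalk_arcs[of xs] hd_notin_Range_vwalk_arcs[of xs]
    by (auto simp: permutations_of_set_def)
  have "inj_on ?f ?L"
  proof (rule inj_onI)
    fix xs ys assume *: "xs \<in> ?L" "ys \<in> ?L" "?f xs = ?f ys"
    show "xs = ys"
    proof (cases "V = {}")
      case True
      then show ?thesis using * by (auto simp: permutations_of_set_def)
    next
      case False
      then obtain a as b bs where ab: "xs = a # as" "ys = b # bs"
        using * by (cases xs; cases ys) (auto simp: permutations_of_set_def)
      \<comment> \<open>First vertices are never heads, so they survive the filter and can be
        compared.\<close>
      have "a = b" "?f as = ?f bs"
        using *(3) hd[OF *(1)] hd[OF *(2)] ab by auto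
      then show ?thesis
        using filter_Range_eq_imp_eq[OF sv, of a as bs] succ[OF *(1)] succ[OF *(2)]
          last[OF *(1)] last[OF *(2)] ab by simp
    qed
  qed
  moreover have "?f ` ?L \<subseteq> permutations_of_set (V - Range S)"
    by (auto simp: permutations_of_set_def)
  ultimately have "card ?L \<le> card (permutations_of_set (V - Range S))"
    using assms by (intro card_inj_on_le) auto
  also have "\<dots> = fact (card V - card S)"
    using assms Range card_Range by (simp add: card_Diff_subset finite_subset)
  finally show ?thesis .
next
  case True
  then show ?thesis by (simp only: card.empty)
qed

text \<open>The bound is uniform in the fixed path \<open>xs\<close>, so the double sum of the
  second moment can be estimated row by row.\<close>

lemma sum_card_common_arcs_le:
  fixes x :: real
  assumes "finite V" "x \<ge> 0" "xs \<in> permutations_of_set V"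
  shows "(\<Sum>ys\<in>permutations_of_set V. (1 + x) ^ card (set (vwalk_arcs xs) \<inter> set (vwalk_arcs ys)))
           \<le> fact (card V) * exp x"
proof -
  let ?n = "card V" and ?P = "permutations_of_set V"
  let ?E = "set (vwalk_arcs xs)"
  have card_E: "card ?E = ?n - 1"
    using assms card_vwalk_arcs[of xs]
    by (auto simp: permutations_of_set_def distinct_card)
  have pow: "(1 + x) ^ card T = (\<Sum>S\<in>Pow T. x ^ card S)" if "finite T" for T :: "('a \<times> 'a) set"
    using prod_add[OF that, of "\<lambda>_. x" "\<lambda>_. 1"] by (simp add: add.commute)
  have "(\<Sum>ys\<in>?P. (1 + x) ^ card (?E \<inter> set (vwalk_arcs ys))) =
        (\<Sum>ys\<in>?P. \<Sum>S\<in>Pow ?E. if S \<subseteq> set (vwalk_arcs ys) then x ^ card S else 0)"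
  proof (rule sum.cong[OF refl])
    fix ys
    have "(1 + x) ^ card (?E \<inter> set (vwalk_arcs ys)) =
          (\<Sum>S\<in>Pow (?E \<inter> set (vwalk_arcs ys)). x ^ card S)"
      by (rule pow) simp
    \<comment> \<open>Padding with zeros frees the index set from \<open>ys\<close>, which permits
      the exchange of sums.\<close>
    also have "\<dots> = (\<Sum>S\<in>Pow ?E. if S \<subseteq> set (vwalk_arcs ys) then x ^ card S else 0)"
      by (intro sum.mono_neutral_cong_left) auto
    finally show "(1 + x) ^ card (?E \<inter> set (vwalk_arcs ys)) = \<dots>" .
  qed
  also have "\<dots> = (\<Sum>S\<in>Pow ?E. \<Sum>ys\<in>?P. if S \<subseteq> set (vwalk_arcs ys) then x ^ card S else 0)"
    by (rule sum.swap)
  also have "\<dots> = (\<Sum>S\<in>Pow ?E. real (card {ys \<in> ?P. S \<subseteq> set (vwalk_arcs ys)}) * x ^ card S)"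
    by (simp add: sum.If_cases Int_def)
  also have "\<dots> \<le> (\<Sum>S\<in>Pow ?E. fact (?n - card S) * x ^ card S)"
  proof (intro sum_mono mult_right_mono)
    fix S
    show "real (card {ys \<in> ?P. S \<subseteq> set (vwalk_arcs ys)}) \<le> fact (?n - card S)"
      using card_permutations_containing_arcs_le[OF assms(1), of S] of_nat_mono by fastforce
  qed (use assms in auto)
  also have "\<dots> = (\<Sum>j\<le>?n - 1. \<Sum>S\<in>{S \<in> Pow ?E. card S = j}. fact (?n - card S) * x ^ card S)"
    by (intro sum.group[symmetric]) (auto simp flip: card_E One_nat_def intro: card_mono)
  also have "\<dots> = (\<Sum>j\<le>?n - 1. real ((?n - 1) choose j) * (fact (?n - j) * x ^ j))"
    by (intro sum.cong) (auto simp: n_subsets card_E)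
  also have "\<dots> \<le> (\<Sum>j\<le>?n - 1. fact ?n * (x ^ j /\<^sub>R fact j))"
  proof (rule sum_mono)
    fix j assume "j \<in> {..?n - 1}"
    then have j: "j \<le> ?n" by simp
    \<comment> \<open>Raising the upper index to \<open>?n\<close> makes the factorials cancel
      exactly, leaving a term of the exponential series.\<close>
    have "real ((?n - 1) choose j) \<le> real (?n choose j)"
      by (intro of_nat_mono binomial_right_mono) simp
    also have "\<dots> = fact ?n / (fact j * fact (?n - j))"
      using j by (rule binomial_fact)
    finally have "real ((?n - 1) choose j) * fact (?n - j) \<le> fact ?n / fact j"
      by (simp add: field_simps)
    from mult_right_mono[OF this, of "x ^ j"]
    show "real ((?n - 1) choose j) * (fact (?n - j) * x ^ j) \<le> fact ?n * (x ^ j /\<^sub>R fact j)"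
      using assms(2) by (simp add: field_simps)
  qed
  also have "\<dots> = fact ?n * (\<Sum>j\<le>?n - 1. x ^ j /\<^sub>R fact j)"
    by (simp add: sum_distrib_left)
  also have "\<dots> \<le> fact ?n * exp x"
  proof (rule mult_left_mono)
    show "(\<Sum>j\<le>?n - 1. x ^ j /\<^sub>R fact j) \<le> exp x"
      unfolding exp_def using assms(2) by (intro sum_le_suminf summable_exp_generic) auto
  qed simp
  finally show ?thesis .
qed

section \<open>Moments of counting variables\<close>

lemma finite_set_random_subset_pmf:
  assumes "finite A"
  shows "finite (set_pmf (random_subset_pmf A q))"
  by (rule finite_subset[of _ "Pow A"]) (use assms in \<open>auto simp: random_subset_pmf_def\<close>)

text \<open>A product event: coordinates in \<open>B\<close> are forced to be true, the others are
  free.\<close>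

lemma prob_random_subset_superset:
  assumes "finite A" "B \<subseteq> A" "0 \<le> q" "q \<le> 1"
  shows "measure_pmf.prob (random_subset_pmf A q) {D. B \<subseteq> D} = q ^ card B"
proof -
  have "measure_pmf.prob (random_subset_pmf A q) {D. B \<subseteq> D} =
        measure_pmf.prob (Pi_pmf A False (\<lambda>_. bernoulli_pmf q))
          (Pi A (\<lambda>a. if a \<in> B then {True} else UNIV))"
    unfolding random_subset_pmf_def measure_map_pmf
    by (rule arg_cong[where f = "measure_pmf.prob _"])
       (use assms(2) in \<open>auto simp: Pi_def split: if_splits\<close>)
  also have "\<dots> = (\<Prod>a\<in>A. if a \<in> B then q else 1)"
    using assms by (subst measure_Pi_pmf_Pi) (auto intro!: prod.cong simp: measure_pmf_single)
  also have "\<dots> = q ^ card B"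
    using assms by (simp add: prod.If_cases Int_absorb1)
  finally show ?thesis .
qed

text \<open>The count is a sum of indicators; in its square, a product of two indicators is the
  indicator for the union \<open>E i \<union> E j\<close>.\<close>

lemma
  assumes "finite A" "finite I" "\<And>i. i \<in> I \<Longrightarrow> E i \<subseteq> A" "0 \<le> q" "q \<le> 1"
  shows expectation_card_contained:
      "measure_pmf.expectation (random_subset_pmf A q) (\<lambda>D. real (card {i \<in> I. E i \<subseteq> D})) =
       (\<Sum>i\<in>I. q ^ card (E i))"
    and expectation_card_contained_squared:
      "measure_pmf.expectation (random_subset_pmf A q) (\<lambda>D. (real (card {i \<in> I. E i \<subseteq> D}))\<^sup>2) =
       (\<Sum>i\<in>I. \<Sum>j\<in>I. q ^ card (E i \<union> E j))"
proof -
  let ?M = "random_subset_pmf A q"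
  have int: "integrable ?M f" for f :: "'a set \<Rightarrow> real"
    using assms(1) by (intro integrable_measure_pmf_finite finite_set_random_subset_pmf)
  note E = prob_random_subset_superset[OF assms(1) _ assms(4,5)]
  have count: "real (card {i \<in> I. E i \<subseteq> D}) = (\<Sum>i\<in>I. indicator {D. E i \<subseteq> D} D)" for D
    using assms(2) by (simp add: indicator_def sum.If_cases Int_def)
  show "measure_pmf.expectation ?M (\<lambda>D. real (card {i \<in> I. E i \<subseteq> D})) = (\<Sum>i\<in>I. q ^ card (E i))"
    unfolding count using assms(3)
    by (subst Bochner_Integration.integral_sum) (auto simp: int E intro!: sum.cong)
  have "(real (card {i \<in> I. E i \<subseteq> D}))\<^sup>2 =
        (\<Sum>i\<in>I. \<Sum>j\<in>I. indicator {D. E i \<union> E j \<subseteq> D} D)" for D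
    unfolding count power2_eq_square sum_product
    by (intro sum.cong) (auto simp: indicator_def)
  moreover have "measure_pmf.prob ?M {D. E i \<union> E j \<subseteq> D} = q ^ card (E i \<union> E j)"
    if "i \<in> I" "j \<in> I" for i j
    using that assms(3) by (intro E) auto
  ultimately show "measure_pmf.expectation ?M (\<lambda>D. (real (card {i \<in> I. E i \<subseteq> D}))\<^sup>2) =
       (\<Sum>i\<in>I. \<Sum>j\<in>I. q ^ card (E i \<union> E j))"
    by (simp add: int)
qed

text \<open>The inequality is kept multiplied out so that an upper bound for the second moment can
  be inserted. A pointwise quadratic majorant of \<open>f\<close> takes the place of
  Cauchy-Schwarz.\<close>

lemma paley_zygmund_half:
  fixes f :: "'a \<Rightarrow> real"
  assumes "finite (set_pmf M)" "measure_pmf.expectation M f > 0"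
  shows "1 / 4 * (measure_pmf.expectation M f)\<^sup>2 \<le>
         measure_pmf.prob M {x. f x \<ge> 1 / 2 * measure_pmf.expectation M f} *
         measure_pmf.expectation M (\<lambda>x. (f x)\<^sup>2)"
proof -
  define m where "m = measure_pmf.expectation M f"
  define s where "s = measure_pmf.expectation M (\<lambda>x. (f x)\<^sup>2)"
  let ?A = "{x. f x \<ge> 1 / 2 * m}"
  have int: "integrable M g" for g :: "'a \<Rightarrow> real"
    using assms(1) by (rule integrable_measure_pmf_finite)
  have m: "m > 0" using assms(2) by (simp add: m_def)
  \<comment> \<open>Nonnegative variance gives \<open>s \<ge> m^2 > 0\<close>, so division by
    \<open>s\<close> is legitimate.\<close>
  have "0 \<le> measure_pmf.expectation M (\<lambda>x. (f x - m)\<^sup>2)"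
    by (rule Bochner_Integration.integral_nonneg) simp
  also have "\<dots> = measure_pmf.expectation M (\<lambda>x. (f x)\<^sup>2 - 2 * m * f x + m\<^sup>2)"
    by (simp add: power2_eq_square algebra_simps)
  also have "\<dots> = s - m\<^sup>2"
    by (simp add: int s_def m_def[symmetric] power2_eq_square)
  finally have s: "s > 0"
    using m by (smt (verit) zero_less_power)
  \<comment> \<open>This \<open>t\<close> maximizes \<open>t * m - t^2 * s\<close>, the lower bound
    for the probability that the majorant yields.\<close>
  define t where "t = m / (2 * s)"
  have t: "t > 0" using m s by (simp add: t_def)
  \<comment> \<open>Off \<open>?A\<close> the term \<open>m / 2\<close> suffices; on
    \<open>?A\<close> the square of \<open>t * f x - 1\<close> is nonnegative.\<close>
  have "f x \<le> m / 2 + (t / 2 * (f x)\<^sup>2 + 1 / (2 * t) * indicator ?A x)" for x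
  proof (cases "x \<in> ?A")
    case True
    have "0 \<le> (t * f x - 1)\<^sup>2 / (2 * t)" using t by simp
    also have "\<dots> = t / 2 * (f x)\<^sup>2 + 1 / (2 * t) - f x"
      using t by (simp add: power2_eq_square field_simps)
    finally show ?thesis using True m by simp
  next
    case False
    then show ?thesis using t by (simp add: add_increasing2)
  qed
  then have "m \<le> measure_pmf.expectation M
      (\<lambda>x. m / 2 + (t / 2 * (f x)\<^sup>2 + 1 / (2 * t) * indicator ?A x))"
    unfolding m_def by (intro integral_mono int)
  also have "\<dots> = m / 2 + (t / 2 * s + 1 / (2 * t) * measure_pmf.prob M ?A)"
    by (simp add: int s_def)
  finally have "1 / 4 * m\<^sup>2 \<le> measure_pmf.prob M ?A * s"
    using m s by (simp add: t_def field_simps power2_eq_square)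
  then show ?thesis by (simp add: m_def s_def)
qed

section \<open>Hamiltonian paths\<close>

text \<open>\<open>n \<ge> 1\<close> excludes the empty list, which is a permutation of the empty
  set but not a \<open>vwalk\<close>.\<close>

lemma hamiltonian_paths_G_digraph:
  assumes "n \<ge> 1"
  shows "hamiltonian_paths (G_digraph n X) =
         {xs \<in> permutations_of_set {1..n}. set (vwalk_arcs xs) \<subseteq> parcs (G_digraph n X)}"
  using assms
  by (auto simp: hamiltonian_paths_def vpath_def vwalk_def G_digraph_def permutations_of_set_def)

theorem theorem3p13:
  fixes n :: nat and p :: real
  assumes "n \<ge> 1" and "0 < p" and "p < 1"
  shows "measure_pmf.prob (random_X_pmf n p)
           {X. real (d_X X {} n) \<ge> 1 / 2 * fact n * p ^ (n - 1)}
         \<ge> 1 / 4 * exp (1 - 1 / p)"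
proof -
  let ?P = "permutations_of_set {1..n}"
  let ?M = "random_subset_pmf (offdiag_pairs n) p"
  let ?E = "\<lambda>xs. set (vwalk_arcs xs)"
  \<comment> \<open>\<open>Y\<close> takes the arc set rather than \<open>X\<close>, so that each
    arc is present with probability \<open>p\<close>.\<close>
  define Y where "Y D = real (card {xs \<in> ?P. ?E xs \<subseteq> D})" for D
  have fin: "finite (offdiag_pairs n)"
    by (rule finite_subset[of _ "{1..n} \<times> {1..n}"]) (auto simp: offdiag_pairs_def)
  have sub: "?E xs \<subseteq> offdiag_pairs n" if "xs \<in> ?P" for xs
    using that vwalk_arcs_offdiag[of xs] by (auto simp: permutations_of_set_def offdiag_pairs_def)
  have card_E: "card (?E xs) = n - 1" if "xs \<in> ?P" for xs
    using that card_vwalk_arcs[of xs] distinct_card[of xs] by (auto simp: permutations_of_set_def)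
  have m: "measure_pmf.expectation ?M Y = fact n * p ^ (n - 1)"
    unfolding Y_def using assms by (subst expectation_card_contained[OF fin _ sub]) (auto simp: card_E)
  have "measure_pmf.expectation ?M (\<lambda>D. (Y D)\<^sup>2) = (\<Sum>xs\<in>?P. \<Sum>ys\<in>?P. p ^ card (?E xs \<union> ?E ys))"
    unfolding Y_def using assms by (intro expectation_card_contained_squared[OF fin _ sub]) auto
  \<comment> \<open>Inclusion-exclusion: sharing k arcs costs a factor \<open>(1 / p) ^ k\<close>,
    with \<open>1 / p\<close> written as \<open>1 + x\<close> for the expansion.\<close>
  also have "\<dots> = (\<Sum>xs\<in>?P. \<Sum>ys\<in>?P. (p ^ (n - 1))\<^sup>2 * (1 + (1 / p - 1)) ^ card (?E xs \<inter> ?E ys))"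
  proof (intro sum.cong refl)
    fix xs ys assume "xs \<in> ?P" "ys \<in> ?P"
    then have "card (?E xs \<union> ?E ys) + card (?E xs \<inter> ?E ys) = (n - 1) + (n - 1)"
      using card_Un_Int[of "?E xs" "?E ys"] card_E by simp
    then have "p ^ card (?E xs \<union> ?E ys) * p ^ card (?E xs \<inter> ?E ys) = (p ^ (n - 1))\<^sup>2"
      by (simp add: power2_eq_square flip: power_add)
    then show "p ^ card (?E xs \<union> ?E ys) = (p ^ (n - 1))\<^sup>2 * (1 + (1 / p - 1)) ^ card (?E xs \<inter> ?E ys)"
      using assms by (simp add: field_simps)
  qed
  also have "\<dots> = (p ^ (n - 1))\<^sup>2 * (\<Sum>xs\<in>?P. \<Sum>ys\<in>?P. (1 + (1 / p - 1)) ^ card (?E xs \<inter> ?E ys))"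
    by (simp only: sum_distrib_left)
  also have "\<dots> \<le> (p ^ (n - 1))\<^sup>2 * (\<Sum>xs\<in>?P. fact (card {1..n}) * exp (1 / p - 1))"
    using assms by (intro mult_left_mono sum_mono sum_card_common_arcs_le) auto
  also have "\<dots> = (fact n * p ^ (n - 1))\<^sup>2 * exp (1 / p - 1)"
    by (simp add: power2_eq_square)
  finally have s: "measure_pmf.expectation ?M (\<lambda>D. (Y D)\<^sup>2) \<le>
    (fact n * p ^ (n - 1))\<^sup>2 * exp (1 / p - 1)" .
  define Q where "Q = measure_pmf.prob ?M {D. Y D \<ge> 1 / 2 * (fact n * p ^ (n - 1))}"
  have "1 / 4 * (fact n * p ^ (n - 1))\<^sup>2 \<le> Q * measure_pmf.expectation ?M (\<lambda>D. (Y D)\<^sup>2)"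
    using paley_zygmund_half[of ?M Y] assms finite_set_random_subset_pmf[OF fin]
    unfolding m Q_def by (simp add: Y_def)
  also have "\<dots> \<le> Q * ((fact n * p ^ (n - 1))\<^sup>2 * exp (1 / p - 1))"
    using s by (rule mult_left_mono) (simp add: Q_def)
  finally have "(fact n * p ^ (n - 1))\<^sup>2 * (1 / 4) \<le>
      (fact n * p ^ (n - 1))\<^sup>2 * (Q * exp (1 / p - 1))"
    by (simp only: mult_ac)
  then have "1 / 4 \<le> Q * exp (1 / p - 1)"
    by (rule mult_left_le_imp_le) (use assms in simp)
  then have "1 / 4 * exp (1 - 1 / p) \<le> Q"
    by (simp add: exp_diff field_simps)
  \<comment> \<open>The arcs of \<open>G_digraph n X\<close> have the law \<open>?M\<close>, so the
    event for \<open>Y\<close> pulls back to one for \<open>X\<close>.\<close>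
  also have "Q = measure_pmf.prob (random_X_pmf n p)
           {X. real (d_X X {} n) \<ge> 1 / 2 * fact n * p ^ (n - 1)}"
    using assms
    by (simp add: Q_def parcs_random_G_digraph[symmetric] vimage_def Y_def
        d_X_empty_eq_card_hamiltonian_paths hamiltonian_paths_G_digraph mult.assoc)
  finally show ?thesis .
qed

end
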